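(* Let $P(\lambda)=\lambda^2A_2+\lambda A_1+A_0$ be a quadratic matrix polynomial with $A_0,A_1,A_2\in\mathbb{C}^{n,n}$, and let $D$ be a nonempty open or closed subset of $\mathbb{C}$. If at least one of the following conditions holds: (a) the multivariate matrix polynomial $(z_1,z_2)\mapsto z_1^2A_2+z_2A_1+A_0$ is stable with respect to $D^2$; (b) the multivariate matrix polynomial $(z_1,z_2)\mapsto z_1z_2A_2+z_2A_1+A_0$ is stable with respect to $D^2$ and $0\notin D$; (c) the multivariate matrix polynomial $(z_1,z_2)\mapsto z_1^2z_2A_2+z_1^2A_1+z_2A_0$ is stable with respect to $D^2$ and $0\notin D$; then the matrix polynomial $P(\lambda)$ is hyperstable with respect to $D$.
   Context: For a nonempty open or closed $D\subseteq\mathbb{C}$: a multivariate matrix polynomial $R(z_1,\dots,z_\kappa)$ with coefficients in $\mathbb{C}^{n,n}$ is stable with respect to $D^\kappa$ if $R(\mu_1,\dots,\mu_\kappa)x\neq0$ for all $(\mu_1,\dots,\mu_\kappa)\in D^\kappa$ and all $x\in\mathbb{C}^n\setminus\{0\}$. A one-variable matrix polynomial $P(\lambda)$ is hyperstable with respect to $D$ if for every $x\in\mathbb{C}^n\setminus\{0\}$ there exists $y\in\mathbb{C}^n\setminus\{0\}$ such that $y^*P(\mu)x\neq0$ for all $\mu\in D$. *)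

theory Defs
  imports "HOL-Analysis.Analysis"
begin

(* The library's *s is not usable for scalar times matrix: on complex ^ 'n ^ 'm its left argument
   is a row of type complex ^ 'n, multiplied componentwise. *)
definition mat_scale :: "complex \<Rightarrow> complex ^ 'n ^ 'm \<Rightarrow> complex ^ 'n ^ 'm" (infixr "*\<^sub>m" 75)
  where "c *\<^sub>m A = (\<chi> i j. c * A $ i $ j)"

(* y^* w *)
definition herm_prod :: "complex ^ 'n \<Rightarrow> complex ^ 'n \<Rightarrow> complex"
  where "herm_prod y w = (\<Sum>i\<in>UNIV. cnj (y $ i) * w $ i)"

(* Matrix polynomials in CARD('k) variables are represented by their evaluation maps; since the
   complex field is infinite, the map determines the polynomial. The index type 'k numbers the
   variables, so a point of complex ^ 'k with all coordinates in D is an element of D^CARD('k). *)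
definition stable_wrt :: "complex set \<Rightarrow> (complex ^ 'k \<Rightarrow> complex ^ 'n ^ 'n) \<Rightarrow> bool"
  where "stable_wrt D R \<longleftrightarrow>
    (\<forall>\<mu>. (\<forall>i. \<mu> $ i \<in> D) \<longrightarrow> (\<forall>x. x \<noteq> 0 \<longrightarrow> R \<mu> *v x \<noteq> 0))"

definition hyperstable_wrt :: "complex set \<Rightarrow> (complex \<Rightarrow> complex ^ 'n ^ 'n) \<Rightarrow> bool"
  where "hyperstable_wrt D P \<longleftrightarrow>
    (\<forall>x. x \<noteq> 0 \<longrightarrow> (\<exists>y. y \<noteq> 0 \<and> (\<forall>\<mu>\<in>D. herm_prod y (P \<mu> *v x) \<noteq> 0)))"

end

theory Submission
  imports Defs
begin

text \<open>
  Fix \<open>x \<noteq> 0\<close> and put \<open>v\<^sub>i = A\<^sub>i x\<close>. If \<open>v\<^sub>0\<close> is not in the span of \<open>v\<^sub>1, v\<^sub>2\<close>, or if the \<open>v\<^sub>i\<close>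
  are all collinear, a suitable \<open>y\<close> is immediate. Otherwise \<open>v\<^sub>0 = s v\<^sub>2 + t v\<^sub>1\<close> with independent
  \<open>v\<^sub>1, v\<^sub>2\<close>, and the polynomials \<open>y\<^sup>* P(\<mu>) x\<close> are exactly the \<open>p\<^sub>2 \<mu>\<^sup>2 + p\<^sub>1 \<mu> + (s p\<^sub>2 + t p\<^sub>1)\<close>.
  Among them are \<open>\<mu> + t\<close>, \<open>\<mu>\<^sup>2 + s\<close> and, for \<open>t \<noteq> 0\<close>, \<open>\<mu>\<^sup>2 - (s/t) \<mu>\<close>. If each of them had a
  zero in \<open>D\<close>, these zeros would give points of \<open>D\<^sup>2\<close> at which the bivariate matrix polynomials
  annihilate \<open>x\<close>: \<open>(z, -t)\<close> with \<open>z\<^sup>2 = -s\<close> for (a), and, as \<open>0 \<notin> D\<close>, \<open>(s/t, -t)\<close> for (b) and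
  \<open>(z, s/t)\<close> for (c).
\<close>

lemma herm_prod_add_right: "herm_prod y (u + w) = herm_prod y u + herm_prod y w"
  by (simp add: herm_prod_def distrib_left sum.distrib)

lemma herm_prod_scale_right: "herm_prod y (c *s w) = c * herm_prod y w"
  by (simp add: herm_prod_def sum_distrib_left mult_ac)

lemma Re_herm_prod: "Re (herm_prod y w) = y \<bullet> w"
  by (simp add: herm_prod_def inner_vec_def inner_complex_def)

lemma mat_scale_mult_vec: "(c *\<^sub>m A) *v x = c *s (A *v x)"
  by (simp add: vec_eq_iff mat_scale_def matrix_vector_mult_def sum_distrib_left mult_ac)

text \<open>The real part of \<open>herm_prod\<close> is the real inner product, so \<open>y\<close>
  can be the component of \<open>v\<close> orthogonal to the span over the reals. As the span is
  closed under multiplication by the imaginary unit, the imaginary parts vanish too.\<close>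

lemma exists_herm_orthogonal_separating:
  fixes v :: "complex ^ 'n"
  assumes "v \<notin> vec.span S"
  obtains y where "\<And>u. u \<in> S \<Longrightarrow> herm_prod y u = 0" "herm_prod y v \<noteq> 0"
proof -
  let ?U = "vec.span S"
  have scaleR_eq: "r *\<^sub>R u = complex_of_real r *s u" for r and u :: "complex ^ 'n"
    by (simp add: vec_eq_iff scaleR_conv_of_real[where 'a = complex])
  have "subspace ?U"
    unfolding subspace_def scaleR_eq by (auto intro: vec.span_zero vec.span_add vec.span_scale)
  then have "span ?U = ?U"
    by (simp add: span_eq_iff)
  then obtain a y where a: "a \<in> ?U" and y: "\<And>w. w \<in> ?U \<Longrightarrow> orthogonal y w" and v: "v = a + y"
    using orthogonal_subspace_decomp_exists[of ?U v] by metis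
  have orth: "herm_prod y u = 0" if "u \<in> ?U" for u
  proof (rule complex_eqI)
    show "Re (herm_prod y u) = Re 0"
      using y[OF that] by (simp add: Re_herm_prod orthogonal_def)
    have "Re (herm_prod y (\<i> *s u)) = 0"
      using y[OF vec.span_scale[OF that]] by (simp add: Re_herm_prod orthogonal_def)
    then show "Im (herm_prod y u) = Im 0"
      by (simp add: herm_prod_scale_right)
  qed
  have "y \<noteq> 0"
    using a v assms by auto
  then have "Re (herm_prod y v) \<noteq> 0"
    by (simp add: v herm_prod_add_right orth[OF a] Re_herm_prod)
  with orth show ?thesis
    by (intro that[of y]) (auto intro: vec.span_base)
qed

text \<open>The pivot \<open>v\<close> carries the polynomial: \<open>y\<close> is chosen orthogonal to the \<open>e\<^sub>i\<close>, so that
  \<open>y\<^sup>* P(\<mu>) x\<close> is a nonzero multiple of \<open>p\<^sub>2 \<mu>\<^sup>2 + p\<^sub>1 \<mu> + p\<^sub>0\<close>.\<close>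

lemma quadratic_nonvanishing_functional:
  fixes v :: "complex ^ 'n"
  assumes "v \<notin> vec.span {e2, e1, e0}"
    and "\<And>\<mu>. \<mu> \<in> D \<Longrightarrow> \<mu>\<^sup>2 * p2 + \<mu> * p1 + p0 \<noteq> 0"
    and "v2 = p2 *s v + e2" "v1 = p1 *s v + e1" "v0 = p0 *s v + e0"
  shows "\<exists>y. y \<noteq> 0 \<and> (\<forall>\<mu>\<in>D. herm_prod y (\<mu>\<^sup>2 *s v2 + \<mu> *s v1 + v0) \<noteq> 0)"
proof -
  obtain y where orth: "\<And>u. u \<in> {e2, e1, e0} \<Longrightarrow> herm_prod y u = 0" and yv: "herm_prod y v \<noteq> 0"
    using exists_herm_orthogonal_separating[OF assms(1)] by metis
  have "herm_prod y (\<mu>\<^sup>2 *s v2 + \<mu> *s v1 + v0) = (\<mu>\<^sup>2 * p2 + \<mu> * p1 + p0) * herm_prod y v" for \<mu>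
    by (simp add: assms(3-5) herm_prod_add_right herm_prod_scale_right orth algebra_simps)
  moreover have "y \<noteq> 0"
    using yv by (auto simp: herm_prod_def)
  ultimately show ?thesis
    using assms(2) yv by auto
qed

lemma span_collinear3:
  fixes w :: "complex ^ 'n"
  assumes "v \<in> vec.span {a *s w, b *s w, c *s w}"
  obtains k where "v = k *s w"
proof -
  obtain i j l where "v - i *s (a *s w) - j *s (b *s w) = l *s (c *s w)"
    using assms by (auto simp: vec.span_breakdown_eq vec.span_singleton)
  then have "v = (i * a + j * b + l * c) *s w"
    by (simp add: vec_eq_iff algebra_simps)
  then show ?thesis
    by (rule that)
qed

lemma quadratic_nonvanishing_functional_or_relation:
  fixes v0 v1 v2 :: "complex ^ 'n"
  assumes "D \<noteq> {}" and nz: "\<And>\<mu>. \<mu> \<in> D \<Longrightarrow> \<mu>\<^sup>2 *s v2 + \<mu> *s v1 + v0 \<noteq> 0"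
    and no: "\<not> (\<exists>y. y \<noteq> 0 \<and> (\<forall>\<mu>\<in>D. herm_prod y (\<mu>\<^sup>2 *s v2 + \<mu> *s v1 + v0) \<noteq> 0))"
  obtains s t z where "v0 = s *s v2 + t *s v1" "- t \<in> D" "z \<in> D" "z\<^sup>2 = - s"
    "0 \<notin> D \<Longrightarrow> s / t \<in> D"
proof -
  note functional = quadratic_nonvanishing_functional[where D = D and ?v2.0 = v2 and ?v1.0 = v1
      and ?v0.0 = v0, THEN notE[OF no]]
  \<comment> \<open>Otherwise the pivot \<open>v0\<close> yields the constant polynomial 1.\<close>
  have "v0 \<in> vec.span {v2, v1}"
    using functional[of v0 v2 v1 0 0 0 1] by (auto simp: insert_commute[of _ 0])
  then obtain s t where v0: "v0 = s *s v2 + t *s v1"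
    by (auto simp: vec.span_breakdown_eq algebra_simps)
  \<comment> \<open>With pivot \<open>w\<close> and zero remainders, \<open>nz\<close> itself rules
    out zeros of the polynomial in \<open>D\<close>.\<close>
  have not_collinear: False
    if "v2 = a *s w" "v1 = b *s w" for a b w
  proof -
    have eq: "\<mu>\<^sup>2 *s v2 + \<mu> *s v1 + v0 = (\<mu>\<^sup>2 * a + \<mu> * b + (s * a + t * b)) *s w" for \<mu>
      by (simp add: v0 that vec_eq_iff algebra_simps)
    have "w \<notin> vec.span {0, 0, 0}"
      using nz \<open>D \<noteq> {}\<close> by (auto simp: eq)
    moreover have "\<mu>\<^sup>2 * a + \<mu> * b + (s * a + t * b) \<noteq> 0" if "\<mu> \<in> D" for \<mu>
      using nz[OF that] unfolding eq by (metis vec.scale_zero_left)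
    ultimately show False
      by (rule functional) (simp_all add: v0 that vec_eq_iff algebra_simps)
  qed
  have indep: False if "c2 *s v2 = c1 *s v1" "c1 \<noteq> 0 \<or> c2 \<noteq> 0" for c1 c2
  proof (cases "c1 = 0")
    case True
    with that show False
      using not_collinear[of 0 v1 1] by auto
  next
    case False
    then have "v1 = (c2 / c1) *s v2"
      using that by (simp add: vec_eq_iff field_simps)
    then show False
      using not_collinear[of 1 v2 "c2 / c1"] by simp
  qed
  have t: "- t \<in> D"
  proof (rule ccontr)
    assume "- t \<notin> D"
    then have "\<mu>\<^sup>2 * 0 + \<mu> * 1 + t \<noteq> 0" if "\<mu> \<in> D" for \<mu>
      using that by (auto simp: add_eq_0_iff2)
    \<comment> \<open>The remainders keep trivial factors to match
      \<open>span_collinear3\<close>.\<close>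
    moreover have "v1 \<notin> vec.span {1 *s v2, 0 *s v2, s *s v2}"
      using indep[of _ 1] by (metis span_collinear3 vec.scale_one one_neq_zero)
    ultimately show False
      using functional[of v1 "1 *s v2" "0 *s v2" "s *s v2" 0 1 t] by (simp add: v0 add.commute)
  qed
  have "\<exists>z\<in>D. z\<^sup>2 = - s"
  proof (rule ccontr)
    assume "\<not> ?thesis"
    then have "\<mu>\<^sup>2 * 1 + \<mu> * 0 + s \<noteq> 0" if "\<mu> \<in> D" for \<mu>
      using that by (auto simp: add_eq_0_iff2)
    moreover have "v2 \<notin> vec.span {0 *s v1, 1 *s v1, t *s v1}"
      using indep[of 1] by (metis span_collinear3 vec.scale_one one_neq_zero)
    ultimately show False
      using functional[of v2 "0 *s v1" "1 *s v1" "t *s v1" 1 0 s] by (simp add: v0)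
  qed
  then obtain z where z: "z \<in> D" "z\<^sup>2 = - s"
    by blast
  have st: "s / t \<in> D" if "0 \<notin> D"
  proof (rule ccontr)
    assume st: "s / t \<notin> D"
    have "t \<noteq> 0"
      using t that by auto
    \<comment> \<open>Making \<open>y\<close> orthogonal to \<open>v0\<close> kills the constant
      term; solving the relation for \<open>v1\<close> gives the linear coefficient.\<close>
    have "\<mu>\<^sup>2 * 1 + \<mu> * (- (s / t)) + 0 \<noteq> 0" if "\<mu> \<in> D" for \<mu>
    proof -
      have "\<mu>\<^sup>2 * 1 + \<mu> * (- (s / t)) + 0 = \<mu> * (\<mu> - s / t)"
        by (simp add: power2_eq_square algebra_simps)
      then show ?thesis
        using that st \<open>0 \<notin> D\<close> by auto
    qed
    moreover have "v2 \<notin> vec.span {0 *s v0, (1 / t) *s v0, 1 *s v0}"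
    proof
      assume "v2 \<in> vec.span {0 *s v0, (1 / t) *s v0, 1 *s v0}"
      then obtain k where k: "v2 = k *s v0"
        by (rule span_collinear3)
      then have "(1 - k * s) *s v2 = (k * t) *s v1"
        by (simp add: v0 vec_eq_iff algebra_simps)
      \<comment> \<open>The two coefficients are not both 0: since \<open>t\<close> is nonzero,
        \<open>k * t = 0\<close> forces \<open>k = 0\<close>, hence
        \<open>1 - k * s = 1\<close>.\<close>
      then show False
        using indep[of "1 - k * s" "k * t"] \<open>t \<noteq> 0\<close> by auto
    qed
    moreover have "v1 = (- (s / t)) *s v2 + (1 / t) *s v0"
      using \<open>t \<noteq> 0\<close> by (simp add: v0 vec_eq_iff field_simps)
    ultimately show False
      using functional[of v2 "0 *s v0" "(1 / t) *s v0" "1 *s v0" 1 "- (s / t)" 0] by simp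
  qed
  show ?thesis
    using that[OF v0 t z st] .
qed

theorem theorem5p2:
  fixes A0 A1 A2 :: "complex ^ 'n ^ 'n" and D :: "complex set"
  assumes "D \<noteq> {}" and "open D \<or> closed D"
    and "stable_wrt D (\<lambda>z :: complex ^ 2. (z $ 1)\<^sup>2 *\<^sub>m A2 + z $ 2 *\<^sub>m A1 + A0)
      \<or> (stable_wrt D (\<lambda>z :: complex ^ 2. (z $ 1 * z $ 2) *\<^sub>m A2 + z $ 2 *\<^sub>m A1 + A0) \<and> 0 \<notin> D)
      \<or> (stable_wrt D (\<lambda>z :: complex ^ 2. ((z $ 1)\<^sup>2 * z $ 2) *\<^sub>m A2 + (z $ 1)\<^sup>2 *\<^sub>m A1 + z $ 2 *\<^sub>m A0)
          \<and> 0 \<notin> D)"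
  shows "hyperstable_wrt D (\<lambda>\<mu>. \<mu>\<^sup>2 *\<^sub>m A2 + \<mu> *\<^sub>m A1 + A0)"
  unfolding hyperstable_wrt_def matrix_vector_mult_add_rdistrib mat_scale_mult_vec
proof (intro allI impI)
  fix x :: "complex ^ 'n"
  assume "x \<noteq> 0"
  define v0 v1 v2 where v_def: "v0 = A0 *v x" "v1 = A1 *v x" "v2 = A2 *v x"
  have stable: "\<forall>a\<in>D. \<forall>b\<in>D. R (vector [a, b]) *v x \<noteq> 0"
    if "stable_wrt D R" for R :: "complex ^ 2 \<Rightarrow> complex ^ 'n ^ 'n"
    using that \<open>x \<noteq> 0\<close> unfolding stable_wrt_def by (simp add: forall_2)
  have cases: "(\<forall>a\<in>D. \<forall>b\<in>D. a\<^sup>2 *s v2 + b *s v1 + v0 \<noteq> 0)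
    \<or> (\<forall>a\<in>D. \<forall>b\<in>D. (a * b) *s v2 + b *s v1 + v0 \<noteq> 0) \<and> 0 \<notin> D
    \<or> (\<forall>a\<in>D. \<forall>b\<in>D. (a\<^sup>2 * b) *s v2 + a\<^sup>2 *s v1 + b *s v0 \<noteq> 0) \<and> 0 \<notin> D"
    using assms(3)
    by (elim disj_forward conj_forward)
      (assumption | (drule stable, simp add: matrix_vector_mult_add_rdistrib mat_scale_mult_vec v_def))+
  have nz: "\<mu>\<^sup>2 *s v2 + \<mu> *s v1 + v0 \<noteq> 0" if "\<mu> \<in> D" for \<mu>
  proof
    assume 0: "\<mu>\<^sup>2 *s v2 + \<mu> *s v1 + v0 = 0"
    \<comment> \<open>On the diagonal \<open>a = b = \<mu>\<close> the first two conditions concern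
      this quadratic directly, the third one \<mu> times it.\<close>
    have "(\<mu>\<^sup>2 * \<mu>) *s v2 + \<mu>\<^sup>2 *s v1 + \<mu> *s v0 = \<mu> *s (\<mu>\<^sup>2 *s v2 + \<mu> *s v1 + v0)"
      by (simp add: vec_eq_iff power2_eq_square algebra_simps)
    then have "(\<mu>\<^sup>2 * \<mu>) *s v2 + \<mu>\<^sup>2 *s v1 + \<mu> *s v0 = 0"
      by (simp add: 0)
    then show False
      using cases that 0 by (metis power2_eq_square)
  qed
  show "\<exists>y. y \<noteq> 0 \<and> (\<forall>\<mu>\<in>D. herm_prod y (\<mu>\<^sup>2 *s (A2 *v x) + \<mu> *s (A1 *v x) + A0 *v x) \<noteq> 0)"
  proof (rule ccontr)
    assume "\<not> ?thesis"
    from quadratic_nonvanishing_functional_or_relation[OF \<open>D \<noteq> {}\<close> nz this[folded v_def]]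
    obtain s t z where v0: "v0 = s *s v2 + t *s v1" and D: "- t \<in> D" "z \<in> D"
      and z: "z\<^sup>2 = - s" and st: "0 \<notin> D \<Longrightarrow> s / t \<in> D"
      by blast
    have t: "t \<noteq> 0" if "0 \<notin> D"
      using that D by auto
    have "z\<^sup>2 *s v2 + (- t) *s v1 + v0 = 0"
      by (simp add: z v0 vec_eq_iff)
    moreover have "(s / t * (- t)) *s v2 + (- t) *s v1 + v0 = 0" if "0 \<notin> D"
      using t[OF that] by (simp add: v0 vec_eq_iff)
    moreover have "(z\<^sup>2 * (s / t)) *s v2 + z\<^sup>2 *s v1 + (s / t) *s v0 = 0" if "0 \<notin> D"
      using t[OF that] by (simp add: z v0 vec_eq_iff field_simps)
    ultimately show False
      using cases D st by metis
  qed
qed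

end
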